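(* Let $p>1$ and let $X\in L^p_{\mathbb R^d}(\mathbb P)$ be a random vector. Assume that the distribution $\mathbb P_X$ is strongly continuous, i.e. $\mathbb P(X\in H)=0$ for every (affine) hyperplane $H$ of $\mathbb R^d$, and that its support has nonempty interior. Then, for every $n\ge1$, the extended $L^p$-mean dual quantization error function $\gamma\mapsto\bar d_{n,p}(X,\gamma)$ is lower semi-continuous on $(\mathbb R^d)^n$. Furthermore, it attains a minimum, and $\bar d_{n,p}(X)$ is decreasing in $n$ down to $0$ as $n\to\infty$.
   Context: $\mathbb R^d$ carries a fixed norm $\|\cdot\|$. For a nonempty finite set $\Gamma=\{x_1,\dots,x_k\}\subset\mathbb R^d$ and $\xi\in\mathbb R^d$, $$F_p(\xi;\Gamma)=\inf\Bigl\{\Bigl(\sum_{i=1}^k\lambda_i\|\xi-x_i\|^p\Bigr)^{1/p}:\ \lambda_i\ge0,\ \sum_i\lambda_i x_i=\xi,\ \sum_i\lambda_i=1\Bigr\},$$ and the extended version is $$\bar F_p(\xi;\Gamma)=\begin{cases}F_p(\xi;\Gamma)&\text{if }\xi\in\operatorname{conv}(\Gamma),\\ \operatorname{dist}(\xi,\Gamma)=\min_{x\in\Gamma}\|\xi-x\|&\text{if }\xi\notin\operatorname{conv}(\Gamma).\end{cases}$$ For $\gamma=(x_1,\dots,x_n)\in(\mathbb R^d)^n$ with value set $\Gamma_\gamma=\{x_1,\dots,x_n\}$, put $\bar d_{n,p}(X,\gamma)=\|\bar F_p(X;\Gamma_\gamma)\|_{L^p}=(\mathbb E\,\bar F_p(X;\Gamma_\gamma)^p)^{1/p}$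 and $\bar d_{n,p}(X)=\inf\{\bar d_{n,p}(X,\gamma):\gamma\in(\mathbb R^d)^n\}$. *)

theory Defs
  imports "HOL-Probability.Probability"
begin

definition is_norm :: "('a::real_vector \<Rightarrow> real) \<Rightarrow> bool" where
  "is_norm N \<longleftrightarrow>
     (\<forall>x. N x = 0 \<longleftrightarrow> x = 0) \<and>
     (\<forall>c x. N (c *\<^sub>R x) = \<bar>c\<bar> * N x) \<and>
     (\<forall>x y. N (x + y) \<le> N x + N y)"

text \<open>
  The first argument \<open>N\<close> of the functions below is the fixed norm on the space. The weights are
  indexed by the points of the finite set \<open>\<Gamma>\<close>. If \<open>\<xi>\<close> is not in the convex hull of \<open>\<Gamma>\<close>, the
  infimum ranges over the empty set and \<open>F\<close> has no meaningful value (the usual convention would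
  be infinity); \<open>F_bar\<close> never uses \<open>F\<close> there.
\<close>

definition F :: "('a::real_vector \<Rightarrow> real) \<Rightarrow> real \<Rightarrow> 'a \<Rightarrow> 'a set \<Rightarrow> real" where
  "F N p \<xi> \<Gamma> = Inf {(\<Sum>x\<in>\<Gamma>. l x * N (\<xi> - x) powr p) powr (1 / p) | l.
     (\<forall>x\<in>\<Gamma>. 0 \<le> l x) \<and> (\<Sum>x\<in>\<Gamma>. l x *\<^sub>R x) = \<xi> \<and> (\<Sum>x\<in>\<Gamma>. l x) = 1}"

definition F_bar :: "('a::real_vector \<Rightarrow> real) \<Rightarrow> real \<Rightarrow> 'a \<Rightarrow> 'a set \<Rightarrow> real" where
  "F_bar N p \<xi> \<Gamma> =
     (if \<xi> \<in> convex hull \<Gamma> then F N p \<xi> \<Gamma> else Min ((\<lambda>x. N (\<xi> - x)) ` \<Gamma>))"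

text \<open>
  The power \<open>('a)\<^sup>n\<close> is the set of extensional functions on \<open>{..<n}\<close>, with the product topology.
\<close>

abbreviation tuples :: "nat \<Rightarrow> (nat \<Rightarrow> 'a) set" where
  "tuples n \<equiv> {..<n} \<rightarrow>\<^sub>E UNIV"

abbreviation tuple_topology :: "nat \<Rightarrow> (nat \<Rightarrow> 'a::topological_space) topology" where
  "tuple_topology n \<equiv> product_topology (\<lambda>_. euclidean) {..<n}"

text \<open>
  For a random vector with finite \<open>p\<close>-th moment, \<open>F_bar\<close> is bounded by a diameter on the convex hull
  and by a distance outside it, so the expectation below is finite and a real-valued integral
  suffices.
\<close>

definition dual_error ::
  "('a::euclidean_space \<Rightarrow> real) \<Rightarrow> 'w measure \<Rightarrow> real \<Rightarrow> ('w \<Rightarrow> 'a) \<Rightarrow> nat \<Rightarrow> (nat \<Rightarrow> 'a) \<Rightarrow> real"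
  where
  "dual_error N M p X n \<gamma> =
     (\<integral>\<omega>. F_bar N p (X \<omega>) (\<gamma> ` {..<n}) powr p \<partial>M) powr (1 / p)"

definition opt_dual_error ::
  "('a::euclidean_space \<Rightarrow> real) \<Rightarrow> 'w measure \<Rightarrow> real \<Rightarrow> ('w \<Rightarrow> 'a) \<Rightarrow> nat \<Rightarrow> real"
  where
  "opt_dual_error N M p X n = (INF \<gamma>\<in>tuples n. dual_error N M p X n \<gamma>)"

definition strongly_continuous :: "'a::euclidean_space measure \<Rightarrow> bool" where
  "strongly_continuous \<mu> \<longleftrightarrow> (\<forall>a b. a \<noteq> 0 \<longrightarrow> emeasure \<mu> {x. a \<bullet> x = b} = 0)"

definition measure_support :: "'a::topological_space measure \<Rightarrow> 'a set" where
  "measure_support \<mu> = {x. \<forall>U. open U \<and> x \<in> U \<longrightarrow> emeasure \<mu> U > 0}"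

definition lower_semicontinuous_map :: "'a topology \<Rightarrow> ('a \<Rightarrow> real) \<Rightarrow> bool" where
  "lower_semicontinuous_map T f \<longleftrightarrow>
     (\<forall>x\<in>topspace T. \<forall>a<f x. \<exists>U. openin T U \<and> x \<in> U \<and> (\<forall>y\<in>U. a < f y))"

end

theory Submission
  imports Defs
begin

text \<open>
  Let \<open>\<gamma>\<^sub>k\<close> be a sequence of \<open>n\<close>-tuples, each of whose components converges or tends to infinity, and
  let \<open>\<Gamma>\<close> be the set of limits of the convergent components. For every \<open>\<xi>\<close> off the boundary of
  \<open>conv \<Gamma>\<close>, the value at \<open>(\<xi>, \<Gamma>)\<close> is at most the lower limit of the values at
  \<open>(\<xi>, \<gamma>\<^sub>k)\<close>: if \<open>\<xi>\<close> lies in the hulls of the \<open>\<gamma>\<^sub>k\<close>, then a limit of nearly optimal weights is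
  admissible for \<open>\<Gamma>\<close>; interior points of \<open>conv \<Gamma>\<close> eventually lie in these hulls; otherwise the value is
  a distance. That boundary is covered by finitely many hyperplanes, hence null, so Fatou's lemma
  carries the inequality over to the errors.

  If all components converge, this is lower semicontinuity. Along a minimizing sequence, not all
  components escape, for then the errors would be unbounded, and \<open>\<Gamma>\<close> yields a minimizer. For the
  limit \<open>0\<close>, the vertices of finitely many small cubes covering a large ball give pointwise
  convergence, dominated by an affine function of the norm.
\<close>

section \<open>Subsequences, hulls of perturbed points, and boundaries of polytopes\<close>

lemma finite_common_subsequence:
  fixes P :: "'i \<Rightarrow> (nat \<Rightarrow> nat) \<Rightarrow> bool"
  assumes "finite J"
    and ex: "\<And>j s. j \<in> J \<Longrightarrow> strict_mono s \<Longrightarrow> \<exists>r::nat \<Rightarrow> nat. strict_mono r \<and> P j (s \<circ> r)"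
    and sub: "\<And>j s (r::nat \<Rightarrow> nat). P j s \<Longrightarrow> strict_mono r \<Longrightarrow> P j (s \<circ> r)"
  obtains s :: "nat \<Rightarrow> nat" where "strict_mono s" "\<And>j. j \<in> J \<Longrightarrow> P j s"
proof -
  have "\<exists>s::nat \<Rightarrow> nat. strict_mono s \<and> (\<forall>j\<in>J. P j s)"
    using assms(1) ex
  proof (induction J rule: finite_induct)
    case empty
    show ?case by (intro exI[of _ id]) (auto simp: strict_mono_def)
  next
    case (insert j J)
    then obtain s where s: "strict_mono s" "\<forall>j\<in>J. P j s" by (metis insertCI)
    \<comment> \<open>\<open>s\<close> already works for all of \<open>J\<close>, and
      \<open>sub\<close> preserves this under thinning; so the refinement only has to secure the
      property for \<open>j\<close>.\<close>
    obtain r where r: "strict_mono r" "P j (s \<circ> r)" using insert.prems[of j s] s(1) by blast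
    show ?case
      using s r sub strict_mono_o[OF s(1) r(1)] by (intro exI[of _ "s \<circ> r"]) (auto simp del: o_apply)
  qed
  then show ?thesis using that by blast
qed

lemma frequently_sequentially_subsequence:
  assumes "\<exists>\<^sub>F k in sequentially. P k"
  shows "\<exists>s :: nat \<Rightarrow> nat. strict_mono s \<and> (\<forall>k. P (s k))"
proof -
  have "infinite {k. P k}"
    using assms by (simp add: cofinite_eq_sequentially[symmetric] frequently_cofinite)
  then show ?thesis
    using enumerate_in_set[of "{k. P k}"]
    by (intro exI[of _ "enumerate {k. P k}"]) (auto simp: strict_mono_enumerate)
qed

text \<open>If a hyperplane with normal \<open>a\<close> separated \<xi> from the moved points, a
  step of length \<open>e / 2\<close> from \<xi> against \<open>a\<close> would still end in the
  original hull. But moving the points changes the functional \<open>a\<close> by at most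
  \<open>e / 2 * norm a\<close>, so all original points have strictly larger values than the end of
  that step.\<close>

lemma interior_convex_hull_perturbation:
  fixes x y :: "'i \<Rightarrow> 'a::euclidean_space"
  assumes fin: "finite I" and e: "0 < e" and ball: "ball \<xi> e \<subseteq> convex hull (x ` I)"
    and close: "\<And>i. i \<in> I \<Longrightarrow> dist (y i) (x i) < e / 2"
  shows "\<xi> \<in> convex hull (y ` I)"
proof (rule ccontr)
  assume "\<xi> \<notin> convex hull (y ` I)"
  moreover have "closed (convex hull (y ` I))" using fin
    by (simp add: compact_imp_closed finite_imp_compact_convex_hull)
  ultimately obtain a b where ab: "a \<bullet> \<xi> < b" "\<forall>z\<in>convex hull (y ` I). a \<bullet> z > b"
    using separating_hyperplane_closed_point[of "convex hull (y ` I)" \<xi>] by auto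
  have "I \<noteq> {}" using ball e by (cases "I = {}") auto
  then obtain i where i: "i \<in> I" by auto
  have a0: "a \<noteq> 0" using ab i hull_inc[of "y i" "y ` I" convex] by fastforce
  define z where "z = \<xi> - (e / 2 / norm a) *\<^sub>R a"
  have "z \<in> convex hull (x ` I)" using ball e a0 by (auto simp: z_def dist_norm)
  moreover have "convex hull (x ` I) \<subseteq> {v. a \<bullet> v \<ge> a \<bullet> \<xi> - e / 2 * norm a + (b - a \<bullet> \<xi>)}"
  proof (rule hull_minimal)
    show "x ` I \<subseteq> {v. a \<bullet> v \<ge> a \<bullet> \<xi> - e / 2 * norm a + (b - a \<bullet> \<xi>)}"
    proof (rule image_subsetI)
      fix i assume i: "i \<in> I"
      have "a \<bullet> y i > b" using ab(2) i by (simp add: hull_inc)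
      moreover have "a \<bullet> (y i - x i) \<le> norm a * (e / 2)"
      proof -
        have "a \<bullet> (y i - x i) \<le> norm a * norm (y i - x i)" by (rule norm_cauchy_schwarz)
        also have "\<dots> \<le> norm a * (e / 2)"
          using close[OF i] by (intro mult_left_mono) (auto simp: dist_norm)
        finally show ?thesis .
      qed
      ultimately show "x i \<in> {v. a \<bullet> v \<ge> a \<bullet> \<xi> - e / 2 * norm a + (b - a \<bullet> \<xi>)}"
        by (simp add: inner_diff_right) argo
    qed
  qed (simp add: convex_halfspace_ge)
  ultimately have "a \<bullet> z \<ge> a \<bullet> \<xi> - e / 2 * norm a + (b - a \<bullet> \<xi>)" by auto
  moreover have "a \<bullet> z = a \<bullet> \<xi> - e / 2 * norm a"
    using a0 by (simp add: z_def inner_diff_right power2_norm_eq_inner[symmetric] power2_eq_square)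
  ultimately show False using ab(1) by simp
qed

text \<open>A hull of dimension below that of the space lies in a hyperplane, together with its
  boundary because it is closed. A full-dimensional hull is a polyhedron whose boundary is the union
  of its finitely many facets, each of smaller dimension.\<close>

lemma frontier_polytope_null:
  fixes \<mu> :: "'a::euclidean_space measure"
  assumes \<mu>: "strongly_continuous \<mu>" "sets \<mu> = sets borel" and fin: "finite \<Gamma>"
  shows "frontier (convex hull \<Gamma>) \<in> null_sets \<mu>"
proof -
  let ?C = "convex hull \<Gamma>"
  have hyp: "{x. a \<bullet> x = b} \<in> null_sets \<mu>" if "a \<noteq> 0" for a b
    using \<mu> that by (auto simp: strongly_continuous_def null_sets_def closed_hyperplane)
  have low: "\<exists>H\<in>null_sets \<mu>. S \<subseteq> H" if "aff_dim S < DIM('a)" for S :: "'a set"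
    using aff_lowdim_subset_hyperplane[OF that] hyp by metis
  have cl: "closed ?C" using fin by (simp add: compact_imp_closed finite_imp_compact_convex_hull)
  have "\<exists>H\<in>null_sets \<mu>. frontier ?C \<subseteq> H"
  proof (cases "aff_dim ?C < DIM('a)")
    case True
    then show ?thesis using low[of ?C] cl by (metis frontier_subset_eq order_trans)
  next
    case False
    then have full: "aff_dim ?C = DIM('a)" using aff_dim_le_DIM[of ?C] by linarith
    have "polyhedron ?C" using fin polytope_imp_polyhedron polytope_convex_hull by blast
    then have "rel_frontier ?C = \<Union> {F. F facet_of ?C}" by (rule rel_frontier_of_polyhedron)
    moreover have "rel_frontier ?C = frontier ?C"
      using full by (simp add: rel_frontier_frontier aff_dim_eq_full)
    ultimately have fr: "frontier ?C = \<Union> {F. F facet_of ?C}" by simp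
    have finF: "finite {F. F facet_of ?C}"
      using finite_polyhedron_facets[OF \<open>polyhedron ?C\<close>] .
    have "\<forall>F\<in>{F. F facet_of ?C}. \<exists>H\<in>null_sets \<mu>. F \<subseteq> H"
      using low full by (auto simp: facet_of_def)
    then obtain H where H: "\<And>F. F facet_of ?C \<Longrightarrow> H F \<in> null_sets \<mu> \<and> F \<subseteq> H F"
      by (metis mem_Collect_eq)
    have "(\<Union>F\<in>{F. F facet_of ?C}. H F) \<in> null_sets \<mu>"
      using H finF by (intro null_sets.finite_UN) auto
    then show ?thesis using fr H by (intro bexI) auto
  qed
  moreover have "frontier ?C \<in> sets \<mu>" using \<mu>(2) by (simp add: frontier_closed borel_closed)
  ultimately show ?thesis using null_sets_subset by blast
qed

lemma powr_add_le:
  fixes a b p :: real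
  assumes "0 \<le> a" "0 \<le> b" "0 \<le> p"
  shows "(a + b) powr p \<le> 2 powr p * (a powr p + b powr p)"
proof -
  have "(a + b) powr p \<le> (2 * max a b) powr p" using assms by (intro powr_mono2) auto
  also have "\<dots> = 2 powr p * max a b powr p" using assms by (simp add: powr_mult)
  also have "\<dots> \<le> 2 powr p * (a powr p + b powr p)"
    by (intro mult_left_mono) (auto simp: max_def)
  finally show ?thesis .
qed

section \<open>Equivalence of the fixed norm \<open>N\<close> with the Euclidean norm\<close>

locale fixed_norm =
  fixes N :: "'a::euclidean_space \<Rightarrow> real"
  assumes is_norm: "is_norm N"
begin

lemma N_0 [simp]: "N 0 = 0"
  and N_eq_0_iff: "N x = 0 \<longleftrightarrow> x = 0"
  and N_scaleR: "N (c *\<^sub>R x) = \<bar>c\<bar> * N x"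
  and N_triangle: "N (x + y) \<le> N x + N y"
  using is_norm by (auto simp: is_norm_def)

lemma N_minus: "N (- x) = N x"
  using N_scaleR[of "-1" x] by simp

lemma N_commute: "N (x - y) = N (y - x)"
  using N_minus[of "x - y"] by simp

lemma N_nonneg [simp]: "0 \<le> N x"
  using N_triangle[of x "-x"] by (simp add: N_minus)

lemma N_diff_le: "N (x - y) \<le> N x + N y"
  using N_triangle[of x "- y"] by (simp add: N_minus)

lemma N_sum_le: "N (sum f A) \<le> (\<Sum>i\<in>A. N (f i))"
proof (cases "finite A")
  case True
  then show ?thesis
    by (induction A rule: finite_induct) (auto intro: order_trans[OF N_triangle])
qed simp

lemma N_upper: obtains B where "0 < B" "\<And>x. N x \<le> B * norm x"
proof
  let ?B = "1 + (\<Sum>b\<in>Basis. N b)"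
  show "0 < ?B" by (simp add: add_pos_nonneg sum_nonneg)
  show "N x \<le> ?B * norm x" for x
  proof -
    have "N x = N (\<Sum>b\<in>Basis. (x \<bullet> b) *\<^sub>R b)" by (simp add: euclidean_representation)
    also have "\<dots> \<le> (\<Sum>b\<in>Basis. \<bar>x \<bullet> b\<bar> * N b)"
      using N_sum_le[of "\<lambda>b. (x \<bullet> b) *\<^sub>R b" Basis] by (simp add: N_scaleR)
    also have "\<dots> \<le> (\<Sum>b\<in>Basis. norm x * N b)"
      by (intro sum_mono mult_right_mono) (auto simp: Basis_le_norm)
    also have "\<dots> \<le> ?B * norm x" by (simp add: sum_distrib_left algebra_simps)
    finally show ?thesis .
  qed
qed

lemma continuous_on_N: "continuous_on S N"
proof -
  obtain B where B: "0 < B" "\<And>x. N x \<le> B * norm x" using N_upper by blast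
  have "\<bar>N x - N y\<bar> \<le> B * norm (x - y)" for x y
    using N_triangle[of "x - y" y] N_triangle[of "y - x" x] B(2)[of "x - y"] N_commute[of x y]
    by (simp add: abs_le_iff)
  then have "B-lipschitz_on S N" using B(1)
    by (intro lipschitz_onI) (auto simp: dist_norm dist_real_def)
  then show ?thesis by (rule lipschitz_on_continuous_on)
qed

lemma tendsto_N: "(f \<longlongrightarrow> l) G \<Longrightarrow> ((\<lambda>x. N (f x)) \<longlongrightarrow> N l) G"
  using continuous_on_N[of UNIV] by (metis UNIV_I continuous_on_def isCont_tendsto_compose
      continuous_at_imp_continuous_at_within at_within_open open_UNIV isCont_def)

text \<open>The continuous function \<open>N\<close> attains its minimum on the compact Euclidean
  unit sphere; the minimum is positive by definiteness, and homogeneity spreads the bound to all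
  vectors.\<close>

lemma N_lower: obtains b where "0 < b" "\<And>x. b * norm x \<le> N x"
proof -
  obtain u where u: "norm u = 1" "\<And>x. norm x = 1 \<Longrightarrow> N u \<le> N x"
    using continuous_attains_inf[of "sphere 0 1" N] continuous_on_N by auto
  show ?thesis
  proof
    show "0 < N u" using u(1) N_eq_0_iff[of u] N_nonneg[of u] by (auto simp: order_less_le simp del: N_nonneg)
    show "N u * norm x \<le> N x" for x
    proof (cases "x = 0")
      case False
      then have "N u \<le> N (inverse (norm x) *\<^sub>R x)" by (intro u(2)) simp
      then show ?thesis using False by (simp add: N_scaleR field_simps)
    qed simp
  qed
qed

lemma N_at_top:
  assumes "filterlim f at_infinity G"
  shows "filterlim (\<lambda>x. N (f x)) at_top G"
proof -
  obtain b where b: "0 < b" "\<And>x. b * norm x \<le> N x" using N_lower by blast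
  have "filterlim (\<lambda>x. b * norm (f x)) at_top G"
    using assms b(1) by (intro filterlim_tendsto_pos_mult_at_top[OF tendsto_const])
      (auto simp: filterlim_at_infinity_imp_norm_at_top)
  then show ?thesis by (rule filterlim_at_top_mono) (simp add: b(2))
qed

end


section \<open>Admissible weights, their costs, and elementary bounds on \<open>F\<close> and
  \<open>F_bar\<close>\<close>

locale dual_quantization = fixed_norm N for N :: "'a::euclidean_space \<Rightarrow> real" +
  fixes p :: real
  assumes p: "1 < p"
begin

text \<open>Weights are indexed by an arbitrary \<open>I\<close> with a family \<open>g\<close>, not
  by points: along a sequence of tuples the points move and may coincide, while the indices stay
  fixed. \<open>weights_push\<close> and \<open>weights_pull\<close> mediate between the two
  forms.\<close>

definition weights :: "'i set \<Rightarrow> ('i \<Rightarrow> 'a) \<Rightarrow> 'a \<Rightarrow> ('i \<Rightarrow> real) \<Rightarrow> bool" where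
  "weights I g \<xi> l \<longleftrightarrow> (\<forall>i\<in>I. 0 \<le> l i) \<and> (\<Sum>i\<in>I. l i *\<^sub>R g i) = \<xi> \<and> (\<Sum>i\<in>I. l i) = 1"

definition cost :: "'i set \<Rightarrow> ('i \<Rightarrow> 'a) \<Rightarrow> 'a \<Rightarrow> ('i \<Rightarrow> real) \<Rightarrow> real" where
  "cost I g \<xi> l = (\<Sum>i\<in>I. l i * N (\<xi> - g i) powr p)"

lemma F_alt: "F N p \<xi> \<Gamma> = Inf {cost \<Gamma> id \<xi> l powr (1 / p) | l. weights \<Gamma> id \<xi> l}"
  by (simp add: F_def cost_def weights_def)

lemma cost_nonneg: "weights I g \<xi> l \<Longrightarrow> 0 \<le> cost I g \<xi> l"
  by (auto simp: weights_def cost_def intro!: sum_nonneg)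

text \<open>Each value receives the total weight of its fibre under \<open>g\<close>.\<close>

lemma weights_push:
  assumes "finite I" "weights I g \<xi> l"
  obtains l' where "weights (g ` I) id \<xi> l'" "cost (g ` I) id \<xi> l' = cost I g \<xi> l"
proof -
  define l' where "l' y = (\<Sum>i\<in>{i. i \<in> I \<and> g i = y}. l i)" for y
  \<comment> \<open>One identity for arbitrary \<open>h\<close> serves three times:
    \<open>h = id\<close> gives the barycentre, the constant 1 the total mass, and the power of the
    distance the cost.\<close>
  have *: "(\<Sum>y\<in>g ` I. l' y *\<^sub>R h y) = (\<Sum>i\<in>I. l i *\<^sub>R h (g i))" for h :: "'a \<Rightarrow> 'c::real_vector"
    by (subst sum.image_gen[OF assms(1), of "\<lambda>i. l i *\<^sub>R h (g i)" g])
      (auto simp: l'_def scaleR_sum_left intro!: sum.cong)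
  show ?thesis
  proof (rule that)
    show "weights (g ` I) id \<xi> l'"
      using assms(2) *[of id] *[of "\<lambda>_. 1::real"]
      by (auto simp: weights_def l'_def intro!: sum_nonneg)
    show "cost (g ` I) id \<xi> l' = cost I g \<xi> l"
      using *[of "\<lambda>y. N (\<xi> - y) powr p"] by (simp add: cost_def)
  qed
qed

text \<open>One index is selected for each value and carries its whole weight; the other indices get
  weight zero.\<close>

lemma weights_pull:
  assumes "finite I" "weights (g ` I) id \<xi> l"
  obtains l' where "weights I g \<xi> l'" "cost I g \<xi> l' = cost (g ` I) id \<xi> l"
proof -
  obtain J where J: "J \<subseteq> I" "inj_on g J" "g ` J = g ` I"
    by (metis subset_image_inj subset_refl)
  define l' where "l' i = (if i \<in> J then l (g i) else 0)" for i
  have *: "(\<Sum>i\<in>I. l' i *\<^sub>R h (g i)) = (\<Sum>y\<in>g ` I. l y *\<^sub>R h y)" for h :: "'a \<Rightarrow> 'c::real_vector"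
  proof -
    have "(\<Sum>y\<in>g ` J. l y *\<^sub>R h y) = (\<Sum>i\<in>J. l (g i) *\<^sub>R h (g i))"
      using J(2) by (simp add: sum.reindex)
    also have "\<dots> = (\<Sum>i\<in>I. l' i *\<^sub>R h (g i))"
      using J(1) assms(1) by (intro sum.mono_neutral_cong_left) (auto simp: l'_def)
    finally show ?thesis using J(3) by simp
  qed
  show ?thesis
  proof (rule that)
    have "0 \<le> l' i" if "i \<in> I" for i
      using assms(2) that by (auto simp: weights_def l'_def)
    then show "weights I g \<xi> l'"
      using assms(2) *[of id] *[of "\<lambda>_. 1::real"] by (simp add: weights_def)
    show "cost I g \<xi> l' = cost (g ` I) id \<xi> l"
      using *[of "\<lambda>y. N (\<xi> - y) powr p"] by (simp add: cost_def)
  qed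
qed

lemma hull_iff_weights:
  assumes "finite \<Gamma>"
  shows "\<xi> \<in> convex hull \<Gamma> \<longleftrightarrow> (\<exists>l. weights \<Gamma> id \<xi> l)"
  using assms by (auto simp: convex_hull_finite weights_def)

lemma weights_imp_hull:
  assumes "finite I" "weights I g \<xi> l"
  shows "\<xi> \<in> convex hull (g ` I)"
  using assms weights_push[OF assms] hull_iff_weights[of "g ` I"] by (metis finite_imageI)

lemma F_le:
  assumes "finite I" "weights I g \<xi> l"
  shows "F N p \<xi> (g ` I) \<le> cost I g \<xi> l powr (1 / p)"
proof -
  obtain l' where l': "weights (g ` I) id \<xi> l'" "cost (g ` I) id \<xi> l' = cost I g \<xi> l"
    using weights_push[OF assms] .
  show ?thesis
    unfolding F_alt using l' by (intro cInf_lower bdd_belowI[of _ 0]) (auto intro!: exI[of _ l'])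
qed

text \<open>The hull hypothesis makes the infimum range over a nonempty set, so a strict upper bound
  yields actual weights; these stand in for a minimizer in the limit arguments.\<close>

lemma F_less_obtain:
  assumes "finite I" "\<xi> \<in> convex hull (g ` I)" "F N p \<xi> (g ` I) < c"
  obtains l where "weights I g \<xi> l" "cost I g \<xi> l < c powr p"
proof -
  have "{cost (g ` I) id \<xi> l powr (1 / p) | l. weights (g ` I) id \<xi> l} \<noteq> {}"
    using assms hull_iff_weights[of "g ` I" \<xi>] by auto
  from cInf_lessD[OF this assms(3)[unfolded F_alt]] obtain l
    where l: "weights (g ` I) id \<xi> l" "cost (g ` I) id \<xi> l powr (1 / p) < c" by auto
  have "cost (g ` I) id \<xi> l < c powr p"
    using powr_less_mono2[of p "cost (g ` I) id \<xi> l powr (1 / p)" c] l p cost_nonneg[OF l(1)]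
    by (simp add: powr_powr)
  with weights_pull[OF assms(1) l(1)] that show ?thesis by metis
qed

text \<open>Weights on \<open>S\<close> extended by zero are admissible for the larger set, and an
  average of powers that are at most \<open>r powr p\<close> is again at most
  \<open>r powr p\<close>. Thus a few nearby points bound the value, however far away the rest of
  \<open>\<Gamma>\<close> lies.\<close>

lemma F_le_of_subset:
  assumes "finite \<Gamma>" "S \<subseteq> \<Gamma>" "\<xi> \<in> convex hull S" "\<And>x. x \<in> S \<Longrightarrow> N (\<xi> - x) \<le> r"
  shows "F N p \<xi> \<Gamma> \<le> r"
proof -
  have finS: "finite S" using assms(1,2) finite_subset by blast
  obtain l where l: "weights S id \<xi> l" using assms(3) hull_iff_weights finS by blast
  have "S \<noteq> {}" using assms(3) by auto
  then have r: "0 \<le> r" using assms(4) N_nonneg order_trans by (metis all_not_in_conv)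
  define l' where "l' x = (if x \<in> S then l x else 0)" for x
  have *: "(\<Sum>x\<in>\<Gamma>. l' x *\<^sub>R h x) = (\<Sum>x\<in>S. l x *\<^sub>R h x)" for h :: "'a \<Rightarrow> 'c::real_vector"
    using assms(1,2) by (intro sum.mono_neutral_cong_right) (auto simp: l'_def)
  have "0 \<le> l' x" for x using l by (auto simp: l'_def weights_def)
  then have w: "weights \<Gamma> id \<xi> l'"
    using l *[of id] *[of "\<lambda>_. 1::real"] by (simp add: weights_def)
  have "cost \<Gamma> id \<xi> l' = (\<Sum>x\<in>S. l x * N (\<xi> - x) powr p)"
    using *[of "\<lambda>y. N (\<xi> - y) powr p"] by (simp add: cost_def)
  also have "\<dots> \<le> (\<Sum>x\<in>S. l x * r powr p)"
    using l assms(4) p by (intro sum_mono mult_left_mono powr_mono2) (auto simp: weights_def)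
  also have "\<dots> = r powr p" using l by (simp add: sum_distrib_right[symmetric] weights_def)
  finally have "cost \<Gamma> id \<xi> l' powr (1 / p) \<le> (r powr p) powr (1 / p)"
    using p cost_nonneg[OF w] by (intro powr_mono2) auto
  moreover have "(r powr p) powr (1 / p) = r" using p r by (simp add: powr_powr)
  ultimately show ?thesis using F_le[OF assms(1) w] by simp
qed

lemma F_ge_dist:
  assumes "finite \<Gamma>" "\<xi> \<in> convex hull \<Gamma>" "0 \<le> r" "\<And>x. x \<in> \<Gamma> \<Longrightarrow> r \<le> N (\<xi> - x)"
  shows "r \<le> F N p \<xi> \<Gamma>"
proof (rule ccontr)
  assume "\<not> r \<le> F N p \<xi> \<Gamma>"
  then obtain l where l: "weights \<Gamma> id \<xi> l" "cost \<Gamma> id \<xi> l < r powr p"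
    using F_less_obtain[of \<Gamma> \<xi> id r] assms(1,2) by auto
  have "r powr p = (\<Sum>x\<in>\<Gamma>. l x * r powr p)"
    using l by (simp add: sum_distrib_right[symmetric] weights_def)
  also have "\<dots> \<le> cost \<Gamma> id \<xi> l"
    unfolding cost_def
    using l assms p by (intro sum_mono mult_left_mono powr_mono2) (auto simp: weights_def)
  finally show False using l by simp
qed

lemma F_bar_nonneg:
  assumes "finite \<Gamma>" "\<Gamma> \<noteq> {}"
  shows "0 \<le> F_bar N p \<xi> \<Gamma>"
  using assms F_ge_dist[of \<Gamma> \<xi> 0] by (auto simp: F_bar_def)

lemma F_bar_le_max:
  assumes "finite \<Gamma>" "\<Gamma> \<noteq> {}" "\<And>x. x \<in> \<Gamma> \<Longrightarrow> N (\<xi> - x) \<le> r"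
  shows "F_bar N p \<xi> \<Gamma> \<le> r"
  using assms F_le_of_subset[of \<Gamma> \<Gamma> \<xi> r] by (auto simp: F_bar_def Min_le_iff)

section \<open>Limits of values along converging and escaping points, and measurability\<close>

text \<open>
  Weights of points that escape to infinity are so small, because \<open>p > 1\<close>, that they
  contribute to the barycentre neither in mass nor in first moment.
\<close>

lemma weights_limit:
  fixes g :: "nat \<Rightarrow> 'i \<Rightarrow> 'a"
  assumes J: "finite J" "I \<subseteq> J"
    and \<xi>: "\<xi> \<longlonglongrightarrow> \<xi>0"
    and conv: "\<And>i. i \<in> I \<Longrightarrow> (\<lambda>k. g k i) \<longlonglongrightarrow> x i"
    and div: "\<And>i. i \<in> J - I \<Longrightarrow> filterlim (\<lambda>k. g k i) at_infinity sequentially"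
    and w: "\<And>k. weights J (g k) (\<xi> k) (l k)"
    and cost: "\<And>k. cost J (g k) (\<xi> k) (l k) \<le> C"
  obtains l0 where "weights I x \<xi>0 l0" "cost I x \<xi>0 l0 \<le> C"
proof -
  have finI: "finite I" using J finite_subset by blast
  have l_nonneg: "0 \<le> l k j" if "j \<in> J" for k j using w that by (auto simp: weights_def)
  have l_le_1: "l k j \<le> 1" if "j \<in> J" for k j
    using w[of k] member_le_sum[OF that, of "l k"] J(1) by (auto simp: weights_def)
  \<comment> \<open>The terms being nonnegative, the bound on the total cost bounds each of them;
    this is what forces the weights of distant points to be small.\<close>
  have C_term: "l k j * N (\<xi> k - g k j) powr p \<le> C" if "j \<in> J" for k j
  proof -
    have "l k j * N (\<xi> k - g k j) powr p \<le> cost J (g k) (\<xi> k) (l k)"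
      unfolding cost_def
      using that J(1) l_nonneg by (intro member_le_sum) auto
    then show ?thesis using cost[of k] by simp
  qed
  obtain s :: "nat \<Rightarrow> nat" where s: "strict_mono s"
    and "\<And>j. j \<in> J \<Longrightarrow> convergent (\<lambda>k. l (s k) j)"
  proof (rule finite_common_subsequence[OF J(1), of "\<lambda>j s. convergent (\<lambda>k. l (s k) j)"])
    fix j and s :: "nat \<Rightarrow> nat"
    assume j: "j \<in> J"
    have "bounded (range (\<lambda>k. l (s k) j))"
      using l_nonneg[OF j] l_le_1[OF j] by (intro boundedI[of _ 1]) auto
    from bounded_imp_convergent_subsequence[OF this]
    show "\<exists>r::nat \<Rightarrow> nat. strict_mono r \<and> convergent (\<lambda>k. l ((s \<circ> r) k) j)"
      by (auto simp: convergent_def o_def)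
  next
    fix j and s r :: "nat \<Rightarrow> nat"
    assume "convergent (\<lambda>k. l (s k) j)" "strict_mono r"
    from convergent_subseq_convergent[OF this]
    show "convergent (\<lambda>k. l ((s \<circ> r) k) j)" by (simp add: o_def)
  qed blast
  then obtain L where L: "\<And>j. j \<in> J \<Longrightarrow> (\<lambda>k. l (s k) j) \<longlonglongrightarrow> L j"
    unfolding convergent_def by metis
  have \<xi>s: "(\<lambda>k. \<xi> (s k)) \<longlonglongrightarrow> \<xi>0" using LIMSEQ_subseq_LIMSEQ[OF \<xi> s] by (simp add: o_def)
  have gs: "(\<lambda>k. g (s k) i) \<longlonglongrightarrow> x i" if "i \<in> I" for i
    using LIMSEQ_subseq_LIMSEQ[OF conv[OF that] s] by (simp add: o_def)
  have moment: "(\<lambda>k. l (s k) j *\<^sub>R g (s k) j) \<longlonglongrightarrow> 0" and mass: "L j = 0" if j: "j \<in> J - I" for j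
  proof -
    let ?R = "\<lambda>k. N (\<xi> (s k) - g (s k) j)"
    have jJ: "j \<in> J" using j by blast
    have "filterlim (\<lambda>k. g (s k) j) at_infinity sequentially"
      using filterlim_compose[OF div[OF j] filterlim_subseq[OF s]] .
    then have "filterlim (\<lambda>k. g (s k) j + - \<xi> (s k)) at_infinity sequentially"
      using tendsto_add_filterlim_at_infinity'[OF _ tendsto_minus[OF \<xi>s]] by blast
    then have R: "filterlim ?R at_top sequentially"
      using N_at_top[of "\<lambda>k. g (s k) j - \<xi> (s k)"] by (simp add: N_commute)
    have R1: "\<forall>\<^sub>F k in sequentially. 1 \<le> ?R k" using R by (simp add: filterlim_at_top)
    have b1: "l (s k) j * ?R k \<le> C * ?R k powr (1 - p)" if "1 \<le> ?R k" for k
    proof -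
      \<comment> \<open>One factor \<open>?R k\<close> is rewritten as
        \<open>?R k powr p * ?R k powr (1 - p)\<close>: the first part is absorbed by the cost
        bound, and the second tends to 0 because \<open>1 - p\<close> is negative.\<close>
      have "l (s k) j * ?R k = l (s k) j * ?R k powr p * ?R k powr (1 - p)"
        using that by (simp add: powr_add[symmetric])
      also have "\<dots> \<le> C * ?R k powr (1 - p)" using C_term[OF jJ] by (intro mult_right_mono) auto
      finally show ?thesis .
    qed
    have lim: "(\<lambda>k. C * ?R k powr (1 - p)) \<longlonglongrightarrow> 0"
      using tendsto_mult_right_zero[OF tendsto_neg_powr[OF _ R, of "1 - p"]] p by simp
    have lR: "(\<lambda>k. l (s k) j * ?R k) \<longlonglongrightarrow> 0"
    proof (rule tendsto_sandwich[OF _ _ tendsto_const lim])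
      show "\<forall>\<^sub>F k in sequentially. 0 \<le> l (s k) j * ?R k" using l_nonneg[OF jJ] by simp
      show "\<forall>\<^sub>F k in sequentially. l (s k) j * ?R k \<le> C * ?R k powr (1 - p)"
        using R1 by eventually_elim (rule b1)
    qed
    have l0: "(\<lambda>k. l (s k) j) \<longlonglongrightarrow> 0"
    proof (rule tendsto_sandwich[OF _ _ tendsto_const lR])
      show "\<forall>\<^sub>F k in sequentially. 0 \<le> l (s k) j" using l_nonneg[OF jJ] by simp
      show "\<forall>\<^sub>F k in sequentially. l (s k) j \<le> l (s k) j * ?R k"
        using R1 by eventually_elim (metis l_nonneg[OF jJ] mult.right_neutral mult_left_mono)
    qed
    then show "L j = 0" using L[OF jJ] LIMSEQ_unique by blast
    obtain b where b: "0 < b" "\<And>x. b * norm x \<le> N x" using N_lower by blast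
    \<comment> \<open>The first moment is estimated relative to \<open>\<xi> (s k)\<close>, where
      \<open>lR\<close> controls it; since the mass tends to 0 and \<open>\<xi> (s k)\<close>
      converges, the shift back to the origin adds nothing in the limit.\<close>
    have "(\<lambda>k. l (s k) j *\<^sub>R (\<xi> (s k) - g (s k) j)) \<longlonglongrightarrow> 0"
    proof (rule Lim_null_comparison)
      have "(\<lambda>k. l (s k) j * ?R k / b) \<longlonglongrightarrow> 0 / b" using b(1) by (intro tendsto_divide lR) auto
      then show "(\<lambda>k. l (s k) j * ?R k / b) \<longlonglongrightarrow> 0" by simp
      show "\<forall>\<^sub>F k in sequentially. norm (l (s k) j *\<^sub>R (\<xi> (s k) - g (s k) j)) \<le> l (s k) j * ?R k / b"
      proof (intro always_eventually allI)
        fix k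
        have "l (s k) j * (b * norm (\<xi> (s k) - g (s k) j)) \<le> l (s k) j * ?R k"
          using b l_nonneg[OF jJ] by (intro mult_left_mono) auto
        then show "norm (l (s k) j *\<^sub>R (\<xi> (s k) - g (s k) j)) \<le> l (s k) j * ?R k / b"
          using b(1) l_nonneg[OF jJ] by (simp add: pos_le_divide_eq mult.commute mult.left_commute)
      qed
    qed
    from tendsto_diff[OF tendsto_scaleR[OF l0 \<xi>s] this]
    show "(\<lambda>k. l (s k) j *\<^sub>R g (s k) j) \<longlonglongrightarrow> 0" by (simp add: algebra_simps)
  qed
  show ?thesis
  proof (rule that)
    have "(\<lambda>k. \<Sum>j\<in>J. l (s k) j) \<longlonglongrightarrow> (\<Sum>j\<in>J. L j)" by (intro tendsto_sum L)
    then have "(\<Sum>j\<in>J. L j) = 1" using w by (simp add: weights_def LIMSEQ_const_iff)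
    moreover have "(\<Sum>j\<in>J. L j) = (\<Sum>j\<in>I. L j)"
      using J mass by (intro sum.mono_neutral_right) auto
    ultimately have 1: "(\<Sum>j\<in>I. L j) = 1" by simp
    have "(\<lambda>k. \<Sum>j\<in>J. l (s k) j *\<^sub>R g (s k) j) \<longlonglongrightarrow> (\<Sum>j\<in>J. if j \<in> I then L j *\<^sub>R x j else 0)"
      using L gs moment J(2) by (intro tendsto_sum) (auto intro: tendsto_scaleR)
    then have "\<xi>0 = (\<Sum>j\<in>J. if j \<in> I then L j *\<^sub>R x j else 0)"
      using w \<xi>s LIMSEQ_unique by (simp add: weights_def)
    also have "\<dots> = (\<Sum>j\<in>I. L j *\<^sub>R x j)"
      using J by (intro sum.mono_neutral_cong_right) auto
    finally have 2: "(\<Sum>j\<in>I. L j *\<^sub>R x j) = \<xi>0" by simp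
    have "0 \<le> L j" if "j \<in> I" for j
      using J(2) that by (intro LIMSEQ_le_const[OF L]) (auto intro: l_nonneg)
    with 1 2 show "weights I x \<xi>0 L" by (simp add: weights_def)
    \<comment> \<open>Only the indices in \<open>I\<close> are passed to the limit: the costs of the
      escaping ones stay bounded but need not tend to 0, and being nonnegative they may be
      dropped.\<close>
    have "(\<lambda>k. cost I (g (s k)) (\<xi> (s k)) (l (s k))) \<longlonglongrightarrow> cost I x \<xi>0 L"
      unfolding cost_def
      using L gs \<xi>s J(2) p
      by (intro tendsto_sum tendsto_mult tendsto_powr' tendsto_N tendsto_diff) auto
    moreover have "cost I (g (s k)) (\<xi> (s k)) (l (s k)) \<le> C" for k
    proof -
      have "cost I (g (s k)) (\<xi> (s k)) (l (s k)) \<le> cost J (g (s k)) (\<xi> (s k)) (l (s k))"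
        unfolding cost_def using J l_nonneg by (intro sum_mono2) auto
      then show ?thesis using cost[of "s k"] by simp
    qed
    ultimately show "cost I x \<xi>0 L \<le> C" by (intro LIMSEQ_le_const2) auto
  qed
qed

text \<open>The lower limit is expressed by strict lower bounds \<open>c\<close>. If
  \<open>I\<close> is empty, the hypothesis on \<open>c\<close> is void, and the conclusion says
  that the values tend to infinity when every point escapes.\<close>

lemma F_bar_liminf:
  fixes g :: "nat \<Rightarrow> 'i \<Rightarrow> 'a"
  assumes J: "finite J" "J \<noteq> {}" "I \<subseteq> J"
    and conv: "\<And>i. i \<in> I \<Longrightarrow> (\<lambda>k. g k i) \<longlonglongrightarrow> x i"
    and div: "\<And>i. i \<in> J - I \<Longrightarrow> filterlim (\<lambda>k. g k i) at_infinity sequentially"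
    and fr: "\<xi> \<notin> frontier (convex hull (x ` I))"
    and c: "I \<noteq> {} \<Longrightarrow> c < F_bar N p \<xi> (x ` I)"
  shows "\<forall>\<^sub>F k in sequentially. c < F_bar N p \<xi> (g k ` J)"
proof -
  have finI: "finite I" using J finite_subset by blast
  let ?C = "convex hull (x ` I)"
  have cl: "closed ?C" using finI by (simp add: compact_imp_closed finite_imp_compact_convex_hull)
  have inside: "\<forall>\<^sub>F k in sequentially. \<not> (\<xi> \<in> convex hull (g k ` J) \<and> F N p \<xi> (g k ` J) \<le> c)"
  proof (rule ccontr)
    assume "\<not> ?thesis"
    then have "\<exists>\<^sub>F k in sequentially. \<xi> \<in> convex hull (g k ` J) \<and> F N p \<xi> (g k ` J) \<le> c"
      by (simp add: frequently_def)
    from frequently_sequentially_subsequence[OF this]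
    obtain s :: "nat \<Rightarrow> nat" where s: "strict_mono s"
      and "\<forall>k. \<xi> \<in> convex hull (g (s k) ` J) \<and> F N p \<xi> (g (s k) ` J) \<le> c"
      by (elim exE conjE)
    then have sC: "\<xi> \<in> convex hull (g (s k) ` J)" and sc: "F N p \<xi> (g (s k) ` J) \<le> c" for k
      by simp_all
    \<comment> \<open>The slack \<open>c < c'\<close> yields the strict bound under which
      \<open>F_less_obtain\<close> produces weights; letting \<open>c'\<close> decrease to
      \<open>c\<close> removes it afterwards.\<close>
    have lim: "\<xi> \<in> ?C \<and> F N p \<xi> (x ` I) \<le> c'" if "c < c'" for c'
    proof -
      have "\<exists>l. weights J (g (s k)) \<xi> l \<and> cost J (g (s k)) \<xi> l \<le> c' powr p" for k
      proof -
        have "F N p \<xi> (g (s k) ` J) < c'" using sc[of k] that by simp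
        from F_less_obtain[OF J(1) sC this]
        obtain l where "weights J (g (s k)) \<xi> l" "cost J (g (s k)) \<xi> l < c' powr p" .
        then show ?thesis by (intro exI[of _ l]) simp
      qed
      then obtain l where l: "\<And>k. weights J (g (s k)) \<xi> (l k)"
        "\<And>k. cost J (g (s k)) \<xi> (l k) \<le> c' powr p" by metis
      have "\<exists>l0. weights I x \<xi> l0 \<and> cost I x \<xi> l0 \<le> c' powr p"
      proof (rule weights_limit[OF J(1,3) tendsto_const[of \<xi>] _ _ l])
        show "(\<lambda>k. g (s k) i) \<longlonglongrightarrow> x i" if "i \<in> I" for i
          using LIMSEQ_subseq_LIMSEQ[OF conv[OF that] s] by (simp add: o_def)
        show "filterlim (\<lambda>k. g (s k) i) at_infinity sequentially" if "i \<in> J - I" for i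
          using filterlim_compose[OF div[OF that] filterlim_subseq[OF s]] .
      qed (intro exI conjI)
      then obtain l0 where l0: "weights I x \<xi> l0" "cost I x \<xi> l0 \<le> c' powr p" by blast
      have "0 \<le> F N p \<xi> (g (s 0) ` J)" using F_ge_dist[OF _ sC[of 0], of 0] J(1) by simp
      then have c': "0 \<le> c'" using sc[of 0] that by linarith
      have "F N p \<xi> (x ` I) \<le> cost I x \<xi> l0 powr (1 / p)" by (rule F_le[OF finI l0(1)])
      also have "\<dots> \<le> (c' powr p) powr (1 / p)"
        using l0 cost_nonneg[OF l0(1)] p by (intro powr_mono2) auto
      also have "\<dots> = c'" using c' p by (simp add: powr_powr)
      finally show ?thesis using weights_imp_hull[OF finI l0(1)] by simp
    qed
    have "\<xi> \<in> ?C" using lim[of "c + 1"] by simp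
    moreover have "F N p \<xi> (x ` I) \<le> c" using lim by (metis dense_ge)
    ultimately show False using c by (cases "I = {}") (auto simp: F_bar_def)
  qed
  show ?thesis
  proof (cases "\<xi> \<in> ?C")
    case True
    then have "\<xi> \<in> interior ?C" using fr cl by (simp add: frontier_def)
    then obtain e where e: "0 < e" "ball \<xi> e \<subseteq> ?C" by (auto simp: mem_interior)
    have "\<forall>\<^sub>F k in sequentially. \<forall>i\<in>I. dist (g k i) (x i) < e / 2"
      using e(1) by (intro eventually_ball_finite finI ballI tendstoD[OF conv]) auto
    with inside show ?thesis
    proof eventually_elim
      case (elim k)
      have "\<xi> \<in> convex hull (g k ` I)"
        using elim(2) by (intro interior_convex_hull_perturbation[OF finI e]) auto
      also have "\<dots> \<subseteq> convex hull (g k ` J)" using J(3) by (intro hull_mono image_mono)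
      finally show ?case using elim(1) by (simp add: F_bar_def)
    qed
  next
    \<comment> \<open>\<xi> may still lie in some of the moving hulls; there \<open>inside\<close>
      eventually gives the bound, and otherwise the value is a minimum of distances to points that
      converge or escape.\<close>
    case False
    have "\<forall>\<^sub>F k in sequentially. c < N (\<xi> - g k j)" if j: "j \<in> J" for j
    proof (cases "j \<in> I")
      case True
      then have "c < Min ((\<lambda>y. N (\<xi> - y)) ` x ` I)" using c False by (auto simp: F_bar_def)
      also have "\<dots> \<le> N (\<xi> - x j)" using True finI by (intro Min_le) auto
      finally have "c < N (\<xi> - x j)" .
      moreover have "(\<lambda>k. N (\<xi> - g k j)) \<longlonglongrightarrow> N (\<xi> - x j)"
        using True by (intro tendsto_N tendsto_diff tendsto_const conv)
      ultimately show ?thesis by (simp add: order_tendstoD(1))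
    next
      case False
      have "filterlim (\<lambda>k. - \<xi> + g k j) at_infinity sequentially"
        using False j by (intro tendsto_add_filterlim_at_infinity[OF tendsto_const] div) auto
      from N_at_top[OF this] have "filterlim (\<lambda>k. N (\<xi> - g k j)) at_top sequentially"
        by (simp add: N_commute[of \<xi>])
      then show ?thesis by (simp add: filterlim_at_top_dense)
    qed
    then have "\<forall>\<^sub>F k in sequentially. \<forall>j\<in>J. c < N (\<xi> - g k j)"
      using J(1) by (intro eventually_ball_finite ballI) auto
    with inside show ?thesis
      by eventually_elim (use J in \<open>auto simp: F_bar_def\<close>)
  qed
qed

text \<open>A sublevel set splits along the convex hull. Its part in the hull is closed, by
  \<open>weights_limit\<close> for a constant family with no escaping points; the rest is a finite
  union of closed \<open>N\<close>-balls minus the hull.\<close>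

lemma F_bar_borel_measurable:
  assumes fin: "finite \<Gamma>" and ne: "\<Gamma> \<noteq> {}"
  shows "(\<lambda>\<xi>. F_bar N p \<xi> \<Gamma>) \<in> borel_measurable borel"
  unfolding borel_measurable_iff_le
proof
  fix c
  let ?C = "convex hull \<Gamma>"
  have cl: "closed ?C" using fin by (simp add: compact_imp_closed finite_imp_compact_convex_hull)
  have "closed {\<xi>. \<xi> \<in> ?C \<and> F N p \<xi> \<Gamma> \<le> c}"
    unfolding closed_sequential_limits
  proof (intro allI impI, elim conjE)
    fix \<xi> \<xi>0
    assume "\<forall>k::nat. \<xi> k \<in> {\<xi>. \<xi> \<in> ?C \<and> F N p \<xi> \<Gamma> \<le> c}" and \<xi>: "\<xi> \<longlonglongrightarrow> \<xi>0"
    then have h: "\<xi> k \<in> ?C" "F N p (\<xi> k) \<Gamma> \<le> c" for k by auto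
    have "0 \<le> F N p (\<xi> 0) \<Gamma>" using F_ge_dist[OF fin h(1)[of 0], of 0] by simp
    then have c: "0 \<le> c" using h(2)[of 0] by linarith
    have "F N p \<xi>0 \<Gamma> \<le> c'" if "c < c'" for c'
    proof -
      have "\<exists>l. weights \<Gamma> id (\<xi> k) l \<and> cost \<Gamma> id (\<xi> k) l \<le> c' powr p" for k
      proof -
        have "\<xi> k \<in> convex hull (id ` \<Gamma>)" "F N p (\<xi> k) (id ` \<Gamma>) < c'"
          using h[of k] that by auto
        from F_less_obtain[OF fin this]
        obtain l where "weights \<Gamma> id (\<xi> k) l" "cost \<Gamma> id (\<xi> k) l < c' powr p" .
        then show ?thesis by (intro exI[of _ l]) simp
      qed
      then obtain l where l: "\<And>k. weights \<Gamma> id (\<xi> k) (l k)"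
        "\<And>k. cost \<Gamma> id (\<xi> k) (l k) \<le> c' powr p" by metis
      obtain l0 where l0: "weights \<Gamma> id \<xi>0 l0" "cost \<Gamma> id \<xi>0 l0 \<le> c' powr p"
        by (rule weights_limit[where I = \<Gamma> and x = id, OF fin order_refl \<xi> _ _ l]) simp_all
      have "F N p \<xi>0 (id ` \<Gamma>) \<le> cost \<Gamma> id \<xi>0 l0 powr (1 / p)" by (rule F_le[OF fin l0(1)])
      also have "\<dots> \<le> (c' powr p) powr (1 / p)"
        using l0 cost_nonneg[OF l0(1)] p by (intro powr_mono2) auto
      also have "\<dots> = c'" using c that p by (simp add: powr_powr)
      finally show ?thesis by simp
    qed
    then have "F N p \<xi>0 \<Gamma> \<le> c" by (rule dense_ge)
    moreover have "\<xi>0 \<in> ?C" using closed_sequentially[OF cl h(1) \<xi>] .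
    ultimately show "\<xi>0 \<in> {\<xi>. \<xi> \<in> ?C \<and> F N p \<xi> \<Gamma> \<le> c}" by simp
  qed
  moreover have "closed {\<xi>. N (\<xi> - x) \<le> c}" for x
    by (intro closed_Collect_le continuous_on_compose2[OF continuous_on_N[of UNIV]] continuous_intros) auto
  then have "closed (\<Union>x\<in>\<Gamma>. {\<xi>. N (\<xi> - x) \<le> c})" using fin by (intro closed_UN) auto
  ultimately have "{\<xi>. \<xi> \<in> ?C \<and> F N p \<xi> \<Gamma> \<le> c} \<union> ((\<Union>x\<in>\<Gamma>. {\<xi>. N (\<xi> - x) \<le> c}) - ?C) \<in> sets borel"
    using cl by (intro sets.Un sets.Diff borel_closed)
  also have "{\<xi>. \<xi> \<in> ?C \<and> F N p \<xi> \<Gamma> \<le> c} \<union> ((\<Union>x\<in>\<Gamma>. {\<xi>. N (\<xi> - x) \<le> c}) - ?C)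
      = {\<xi> \<in> space borel. F_bar N p \<xi> \<Gamma> \<le> c}"
    using fin ne by (auto simp: F_bar_def Min_le_iff)
  finally show "{\<xi> \<in> space borel. F_bar N p \<xi> \<Gamma> \<le> c} \<in> sets borel" .
qed

text \<open>A point of the ball is a convex combination of the vertices of one small cube, all close
  to it, so \<open>F_le_of_subset\<close> applies. The vertices stay in a ball only slightly larger,
  which later yields a majorant independent of the radius.\<close>

lemma small_F_bar_on_ball:
  assumes e: "0 < e" and m: "0 < m"
  obtains \<Gamma> where "finite \<Gamma>" "\<Gamma> \<noteq> {}" "\<Gamma> \<subseteq> cball 0 (m + 1)"
    "\<And>\<xi>. norm \<xi> \<le> m \<Longrightarrow> F_bar N p \<xi> \<Gamma> \<le> e"
proof -
  obtain B where B: "0 < B" "\<And>x. N x \<le> B * norm x" using N_upper by blast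
  \<comment> \<open>With half side \<open>d\<close>, the sum of the coordinates bounds the Euclidean
    distance from the centre of a cube by \<open>r\<close>, so two points of a cube are at
    \<open>N\<close>-distance at most \<open>2 * B * r\<close>, hence at most \<open>e\<close>;
    \<open>r \<le> 1\<close> keeps the vertices in \<open>cball 0 (m + 1)\<close>.\<close>
  define r where "r = min 1 (e / (2 * B))"
  define d where "d = r / real DIM('a)"
  have r: "0 < r" "r \<le> 1" "2 * B * r \<le> e"
    using e B(1) by (auto simp: r_def min_def field_simps)
  have d: "0 < d" using r by (simp add: d_def)
  define v where "v = (\<Sum>i\<in>Basis. d *\<^sub>R i :: 'a)"
  have v: "v \<bullet> i = d" if "i \<in> Basis" for i
    using that by (simp add: v_def inner_sum_left inner_Basis if_distrib cong: if_cong)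
  have near: "norm (y - x) \<le> r" if "y \<in> cbox (x - v) (x + v)" for x y
  proof -
    have "norm (y - x) \<le> (\<Sum>i\<in>Basis. \<bar>(y - x) \<bullet> i\<bar>)" by (rule norm_le_l1)
    also have "\<dots> \<le> (\<Sum>i\<in>(Basis::'a set). d)"
      using that by (intro sum_mono) (force simp: mem_box inner_diff_left inner_add_left v abs_le_iff)
    finally show ?thesis by (simp add: d_def)
  qed
  have "\<exists>S. finite S \<and> cbox (x - v) (x + v) = convex hull S" for x
    using cube_convex_hull[OF d, of x] unfolding v_def by metis
  then obtain S where S: "\<And>x. finite (S x)" "\<And>x. cbox (x - v) (x + v) = convex hull (S x)"
    by metis
  have S_near: "norm (y - x) \<le> r" if "y \<in> S x" for x y
    using that near S(2) hull_inc by metis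
  have "cball 0 m \<subseteq> (\<Union>x\<in>cball 0 m. box (x - v) (x + v))"
    using d by (force simp: mem_box inner_diff_left inner_add_left v)
  then obtain T where T: "T \<subseteq> cball 0 m" "finite T" "cball 0 m \<subseteq> (\<Union>x\<in>T. box (x - v) (x + v))"
    by (rule compactE_image[OF compact_cball open_box]) auto
  define \<Gamma> where "\<Gamma> = (\<Union>x\<in>T. S x)"
  have fin: "finite \<Gamma>" using T S by (simp add: \<Gamma>_def)
  have cov: "\<exists>x\<in>T. \<xi> \<in> convex hull (S x)" if "norm \<xi> \<le> m" for \<xi>
  proof -
    have "\<xi> \<in> (\<Union>x\<in>T. box (x - v) (x + v))" using T(3) that by auto
    then show ?thesis using S(2) box_subset_cbox by blast
  qed
  show ?thesis
  proof (rule that[OF fin])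
    obtain x where "x \<in> T" "0 \<in> convex hull (S x)" using cov[of 0] m by auto
    then have "S x \<noteq> {}" by auto
    then show "\<Gamma> \<noteq> {}" using \<open>x \<in> T\<close> by (auto simp: \<Gamma>_def)
    show "\<Gamma> \<subseteq> cball 0 (m + 1)"
    proof
      fix y assume "y \<in> \<Gamma>"
      then obtain x where x: "x \<in> T" "y \<in> S x" by (auto simp: \<Gamma>_def)
      have "norm y \<le> norm x + norm (y - x)" using norm_triangle_sub by blast
      also have "\<dots> \<le> m + 1" using T(1) x S_near[OF x(2)] r(2) by (intro add_mono) auto
      finally show "y \<in> cball 0 (m + 1)" by simp
    qed
    fix \<xi> :: 'a
    assume "norm \<xi> \<le> m"
    then obtain x where x: "x \<in> T" "\<xi> \<in> convex hull (S x)" using cov by blast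
    have sub: "S x \<subseteq> \<Gamma>" using x by (auto simp: \<Gamma>_def)
    have "F N p \<xi> \<Gamma> \<le> e"
    proof (rule F_le_of_subset[OF fin sub x(2)])
      fix y assume "y \<in> S x"
      then have "norm (\<xi> - x) + norm (y - x) \<le> 2 * r"
        using S_near[of y x] near[of \<xi> x] S(2)[of x] x(2) by auto
      moreover have "norm (\<xi> - y) \<le> norm (\<xi> - x) + norm (y - x)"
        by (metis norm_minus_commute norm_triangle_ineq diff_add_cancel add_diff_eq)
      ultimately have "B * norm (\<xi> - y) \<le> B * (2 * r)" using B(1) by (intro mult_left_mono) auto
      then show "N (\<xi> - y) \<le> e" using B(2)[of "\<xi> - y"] r(3) by simp
    qed
    moreover have "\<xi> \<in> convex hull \<Gamma>" using x(2) hull_mono[OF sub] by blast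
    ultimately show "F_bar N p \<xi> \<Gamma> \<le> e" by (simp add: F_bar_def)
  qed
qed

end

section \<open>Integrals of \<open>F_bar\<close> along a random vector\<close>

locale dual_quantization_vector = dual_quantization N p + prob_space M
  for N :: "'a::euclidean_space \<Rightarrow> real" and p :: real and M :: "'w measure" +
  fixes X :: "'w \<Rightarrow> 'a"
  assumes X_measurable [measurable]: "X \<in> borel_measurable M"
    and X_integrable: "integrable M (\<lambda>\<omega>. N (X \<omega>) powr p)"
    and X_strongly_continuous: "strongly_continuous (distr M borel X)"
begin

lemma integrable_F_bar:
  assumes "finite \<Gamma>" "\<Gamma> \<noteq> {}"
  shows "integrable M (\<lambda>\<omega>. F_bar N p (X \<omega>) \<Gamma> powr p)"
proof (rule Bochner_Integration.integrable_bound)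
  let ?C = "\<Sum>x\<in>\<Gamma>. N x"
  show "integrable M (\<lambda>\<omega>. 2 powr p * (N (X \<omega>) powr p + ?C powr p))"
    using X_integrable by simp
  have [measurable]: "(\<lambda>\<xi>. F_bar N p \<xi> \<Gamma>) \<in> borel_measurable borel"
    by (rule F_bar_borel_measurable[OF assms])
  show "(\<lambda>\<omega>. F_bar N p (X \<omega>) \<Gamma> powr p) \<in> borel_measurable M"
    by measurable
  have "F_bar N p \<xi> \<Gamma> powr p \<le> 2 powr p * (N \<xi> powr p + ?C powr p)" for \<xi>
  proof -
    have "F_bar N p \<xi> \<Gamma> \<le> N \<xi> + ?C"
    proof (rule F_bar_le_max[OF assms])
      fix x assume "x \<in> \<Gamma>"
      then have "N x \<le> ?C" using assms(1) by (intro member_le_sum) auto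
      then show "N (\<xi> - x) \<le> N \<xi> + ?C" using N_diff_le[of \<xi> x] by linarith
    qed
    then have "F_bar N p \<xi> \<Gamma> powr p \<le> (N \<xi> + ?C) powr p"
      using p F_bar_nonneg[OF assms] by (intro powr_mono2) auto
    also have "\<dots> \<le> 2 powr p * (N \<xi> powr p + ?C powr p)" using p by (intro powr_add_le sum_nonneg) auto
    finally show ?thesis .
  qed
  then show "AE \<omega> in M. norm (F_bar N p (X \<omega>) \<Gamma> powr p) \<le> norm (2 powr p * (N (X \<omega>) powr p + ?C powr p))"
    by (auto intro!: AE_I2)
qed

lemma AE_not_in_frontier:
  assumes "finite \<Gamma>"
  shows "AE \<omega> in M. X \<omega> \<notin> frontier (convex hull \<Gamma>)"
proof -
  have "frontier (convex hull \<Gamma>) \<in> null_sets (distr M borel X)"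
    by (rule frontier_polytope_null[OF X_strongly_continuous _ assms]) simp
  from AE_distrD[OF X_measurable AE_not_in[OF this]] show ?thesis .
qed

text \<open>Both claims come from Fatou's lemma and the pointwise bound \<open>F_bar_liminf\<close>.
  If every point escaped, the lower limit would be infinite everywhere, against the finite bound
  \<open>a\<close>. Upper bounds \<open>A k\<close> in place of exact values suit approximate
  minimizers.\<close>

lemma integral_F_bar_liminf:
  fixes g :: "nat \<Rightarrow> 'i \<Rightarrow> 'a"
  assumes J: "finite J" "J \<noteq> {}" "I \<subseteq> J"
    and conv: "\<And>i. i \<in> I \<Longrightarrow> (\<lambda>k. g k i) \<longlonglongrightarrow> x i"
    and div: "\<And>i. i \<in> J - I \<Longrightarrow> filterlim (\<lambda>k. g k i) at_infinity sequentially"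
    and A: "\<And>k. (\<integral>\<omega>. F_bar N p (X \<omega>) (g k ` J) powr p \<partial>M) \<le> A k" "A \<longlonglongrightarrow> a"
  shows "I \<noteq> {}" and "(\<integral>\<omega>. F_bar N p (X \<omega>) (x ` I) powr p \<partial>M) \<le> a"
proof -
  have finI: "finite I" using J finite_subset by blast
  define h where "h k \<omega> = ennreal (F_bar N p (X \<omega>) (g k ` J) powr p)" for k \<omega>
  have int: "integrable M (\<lambda>\<omega>. F_bar N p (X \<omega>) (g k ` J) powr p)" for k
    using J by (intro integrable_F_bar) auto
  have h_meas: "h k \<in> borel_measurable M" for k
    unfolding h_def using int[of k] by measurable
  have "(\<integral>\<^sup>+\<omega>. h k \<omega> \<partial>M) \<le> ennreal (A k)" for k
    unfolding h_def using A(1)[of k] by (subst nn_integral_eq_integral[OF int]) (auto intro: ennreal_leI)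
  then have "liminf (\<lambda>k. \<integral>\<^sup>+\<omega>. h k \<omega> \<partial>M) \<le> liminf (\<lambda>k. ennreal (A k))"
    by (intro Liminf_mono always_eventually allI)
  also have "\<dots> = ennreal a"
    by (intro lim_imp_Liminf tendsto_ennrealI A(2)) simp
  finally have fatou: "(\<integral>\<^sup>+\<omega>. liminf (\<lambda>k. h k \<omega>) \<partial>M) \<le> ennreal a"
    by (rule order_trans[OF nn_integral_liminf[OF h_meas]])
  have key: "\<forall>\<^sub>F k in sequentially. ennreal r < h k \<omega>"
    if fr: "X \<omega> \<notin> frontier (convex hull (x ` I))"
      and r: "0 \<le> r" "I \<noteq> {} \<Longrightarrow> r < F_bar N p (X \<omega>) (x ` I) powr p" for \<omega> r
  proof -
    have "\<forall>\<^sub>F k in sequentially. r powr (1 / p) < F_bar N p (X \<omega>) (g k ` J)"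
    proof (rule F_bar_liminf[OF J conv div fr])
      assume "I \<noteq> {}"
      then have "r powr (1 / p) < (F_bar N p (X \<omega>) (x ` I) powr p) powr (1 / p)"
        using r p by (intro powr_less_mono2) auto
      also have "\<dots> = F_bar N p (X \<omega>) (x ` I)"
        using p F_bar_nonneg[of "x ` I"] finI \<open>I \<noteq> {}\<close> by (simp add: powr_powr)
      finally show "r powr (1 / p) < F_bar N p (X \<omega>) (x ` I)" .
    qed
    then show ?thesis
    proof eventually_elim
      case (elim k)
      then have "(r powr (1 / p)) powr p < F_bar N p (X \<omega>) (g k ` J) powr p"
        using p by (intro powr_less_mono2) auto
      then show ?case using r(1) p by (simp add: h_def powr_powr ennreal_less_iff)
    qed
  qed
  show ne: "I \<noteq> {}"
  proof
    assume I: "I = {}"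
    have "liminf (\<lambda>k. h k \<omega>) = top" for \<omega>
    proof -
      \<comment> \<open>With \<open>I\<close> empty the hull has no boundary, so \<open>key\<close>
        applies at every \<omega> and to every threshold \<open>real n\<close>.\<close>
      have le: "ennreal (real n) \<le> liminf (\<lambda>k. h k \<omega>)" for n
        using key[of \<omega> "real n"] I by (intro Liminf_bounded) (auto elim: eventually_mono)
      show ?thesis
      proof (cases "liminf (\<lambda>k. h k \<omega>)")
        case (real r)
        then have "real n \<le> r" for n using le[of n] by simp
        then show ?thesis using reals_Archimedean2[of r] by (meson not_le)
      qed
    qed
    then show False using fatou emeasure_space_1 by (simp add: top_unique)
  qed
  have int': "integrable M (\<lambda>\<omega>. F_bar N p (X \<omega>) (x ` I) powr p)"
    using finI ne by (intro integrable_F_bar) auto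
  have "AE \<omega> in M. ennreal (F_bar N p (X \<omega>) (x ` I) powr p) \<le> liminf (\<lambda>k. h k \<omega>)"
    using AE_not_in_frontier[OF finite_imageI[OF finI, of x]]
  proof eventually_elim
    case fr: (elim \<omega>)
    show ?case
      unfolding le_Liminf_iff
    proof (intro allI impI)
      fix y assume y: "y < ennreal (F_bar N p (X \<omega>) (x ` I) powr p)"
      then obtain r where r: "y = ennreal r" "0 \<le> r" by (cases y) auto
      show "\<forall>\<^sub>F k in sequentially. y < h k \<omega>"
        unfolding r(1) using y r by (intro key[OF fr]) (auto simp: ennreal_less_iff)
    qed
  qed
  then have "(\<integral>\<^sup>+\<omega>. ennreal (F_bar N p (X \<omega>) (x ` I) powr p) \<partial>M) \<le> ennreal a"
    by (rule order_trans[OF nn_integral_mono_AE fatou])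
  \<comment> \<open>\<open>ennreal\<close> sends negative numbers to 0, so the sign of
    \<open>a\<close> is needed to return to a real inequality.\<close>
  moreover have "0 \<le> a"
  proof (rule LIMSEQ_le_const[OF A(2)])
    have "0 \<le> A k" for k by (rule order_trans[OF integral_nonneg_AE A(1)]) simp
    then show "\<exists>n. \<forall>k\<ge>n. 0 \<le> A k" by blast
  qed
  ultimately show "(\<integral>\<omega>. F_bar N p (X \<omega>) (x ` I) powr p \<partial>M) \<le> a"
    by (subst (asm) nn_integral_eq_integral[OF int']) auto
qed

section \<open>Semicontinuity, minimizers and limit of the error\<close>

abbreviation error :: "nat \<Rightarrow> (nat \<Rightarrow> 'a) \<Rightarrow> real" where
  "error \<equiv> dual_error N M p X"

lemma error_nonneg: "0 \<le> error n \<gamma>"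
  by (simp add: dual_error_def)

lemma error_le_iff:
  assumes "0 \<le> a"
  shows "error n \<gamma> \<le> a \<longleftrightarrow> (\<integral>\<omega>. F_bar N p (X \<omega>) (\<gamma> ` {..<n}) powr p \<partial>M) \<le> a powr p"
proof -
  define v where "v = (\<integral>\<omega>. F_bar N p (X \<omega>) (\<gamma> ` {..<n}) powr p \<partial>M)"
  have v: "0 \<le> v" unfolding v_def by (intro integral_nonneg_AE) simp
  have "v powr (1 / p) \<le> a \<longleftrightarrow> v powr (1 / p) \<le> (a powr p) powr (1 / p)"
    using assms p by (simp add: powr_powr)
  also have "\<dots> \<longleftrightarrow> v \<le> a powr p"
    using v p powr_mono2[of "1 / p" v "a powr p"] powr_less_mono2[of "1 / p" "a powr p" v]
    by (cases "v \<le> a powr p") auto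
  finally show ?thesis by (simp add: dual_error_def v_def)
qed

text \<open>A failure at \<open>x\<close> produces, from products of balls with radii tending to 0,
  tuples converging to \<open>x\<close> in every component with errors at most \<open>a\<close>. No
  index escapes, so the integral inequality with \<open>I\<close> the whole index set contradicts
  \<open>a < error n x\<close>.\<close>

lemma lower_semicontinuous_error:
  assumes n: "1 \<le> n"
  shows "lower_semicontinuous_map (tuple_topology n) (error n)"
  unfolding lower_semicontinuous_map_def
proof (intro ballI allI impI, rule ccontr)
  fix x a
  assume x: "x \<in> topspace (tuple_topology n :: (nat \<Rightarrow> 'a) topology)" and a: "a < error n x"
    and no: "\<not> (\<exists>U. openin (tuple_topology n) U \<and> x \<in> U \<and> (\<forall>y\<in>U. a < error n y))"
  have "\<exists>y \<in> {..<n} \<rightarrow>\<^sub>E UNIV. (\<forall>i<n. dist (x i) (y i) < inverse (real (Suc k))) \<and> error n y \<le> a" for k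
  proof -
    let ?U = "PiE {..<n} (\<lambda>i. ball (x i) (inverse (real (Suc k))))"
    have "openin (tuple_topology n) ?U" by (simp add: openin_PiE)
    moreover have "x \<in> ?U" using x by (auto simp: PiE_iff)
    ultimately obtain y where "y \<in> ?U" "error n y \<le> a" using no by (meson not_le_imp_less)
    then show ?thesis by (intro bexI[of _ y]) (auto simp: PiE_iff)
  qed
  then obtain g where g: "\<And>k i. i < n \<Longrightarrow> dist (x i) (g k i) < inverse (real (Suc k))"
    and err: "\<And>k. error n (g k) \<le> a" by metis
  have lim: "(\<lambda>k. g k i) \<longlonglongrightarrow> x i" if "i \<in> {..<n}" for i
  proof -
    have "(\<lambda>k. dist (g k i) (x i)) \<longlonglongrightarrow> 0"
      using g[of i] that
      by (intro Lim_null_comparison[OF _ LIMSEQ_inverse_real_of_nat] always_eventually)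
        (auto simp: dist_commute less_imp_le)
    then show ?thesis by (simp add: tendsto_dist_iff[of _ "x i"])
  qed
  have a0: "0 \<le> a" using error_nonneg err[of 0] by (rule order_trans)
  have "(\<integral>\<omega>. F_bar N p (X \<omega>) (x ` {..<n}) powr p \<partial>M) \<le> a powr p"
    using n err error_le_iff[OF a0]
    by (intro integral_F_bar_liminf(2)[OF _ _ order_refl lim _ _ tendsto_const])
      (auto simp: lessThan_empty_iff)
  then show False using a error_le_iff[OF a0] by force
qed

lemma opt_le_error:
  assumes "\<gamma> \<in> tuples n"
  shows "opt_dual_error N M p X n \<le> error n \<gamma>"
  unfolding opt_dual_error_def
  using assms error_nonneg by (intro cINF_lower bdd_belowI2[of _ 0]) auto

lemma opt_nonneg: "0 \<le> opt_dual_error N M p X n"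
  unfolding opt_dual_error_def
  using error_nonneg by (intro cINF_greatest) (auto simp: PiE_eq_empty_iff)

lemma opt_attained:
  assumes n: "1 \<le> n"
  shows "\<exists>\<gamma>\<in>tuples n. \<forall>\<gamma>'\<in>tuples n. error n \<gamma> \<le> error n \<gamma>'"
proof -
  let ?D = "opt_dual_error N M p X n"
  have "\<exists>\<gamma>\<in>tuples n. error n \<gamma> < ?D + inverse (real (Suc k))" for k
  proof -
    have "(error n ` tuples n) \<noteq> {}" by (auto simp: PiE_eq_empty_iff)
    moreover have "Inf (error n ` tuples n) < ?D + inverse (real (Suc k))"
      by (simp add: opt_dual_error_def)
    ultimately have "\<exists>v\<in>error n ` tuples n. v < ?D + inverse (real (Suc k))" by (rule cInf_lessD)
    then show ?thesis by blast
  qed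
  then obtain g where g: "\<And>k. error n (g k) < ?D + inverse (real (Suc k))" by metis
  let ?P = "\<lambda>j s. convergent (\<lambda>k. g (s k) j) \<or> filterlim (\<lambda>k. g (s k) j) at_infinity sequentially"
  obtain s :: "nat \<Rightarrow> nat" where s: "strict_mono s" and sP: "\<And>j. j \<in> {..<n} \<Longrightarrow> ?P j s"
  proof (rule finite_common_subsequence[OF finite_lessThan[of n], of ?P])
    fix j and s :: "nat \<Rightarrow> nat"
    let ?f = "\<lambda>k. g (s k) j"
    show "\<exists>r::nat \<Rightarrow> nat. strict_mono r \<and> ?P j (s \<circ> r)"
    proof (cases "filterlim ?f at_infinity sequentially")
      case True
      then show ?thesis by (intro exI[of _ id]) (auto simp: strict_mono_def)
    next
      case False
      \<comment> \<open>A component that does not tend to infinity returns to a bounded set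
        infinitely often, and a bounded sequence has a convergent subsequence.\<close>
      then obtain K where "\<not> (\<forall>\<^sub>F k in sequentially. K \<le> norm (?f k))"
        by (auto simp: filterlim_at_infinity[OF order_refl])
      then have "\<exists>\<^sub>F k in sequentially. norm (?f k) < K" by (simp add: not_eventually not_le)
      from frequently_sequentially_subsequence[OF this]
      obtain r :: "nat \<Rightarrow> nat" where r: "strict_mono r" "\<forall>k. norm (?f (r k)) < K" by (elim exE conjE)
      then have "bounded (range (\<lambda>k. ?f (r k)))" by (intro boundedI[of _ K]) (auto simp: less_imp_le)
      from bounded_imp_convergent_subsequence[OF this]
      obtain l q where q: "strict_mono (q::nat \<Rightarrow> nat)" "((\<lambda>k. ?f (r k)) \<circ> q) \<longlonglongrightarrow> l" by blast
      then have "convergent (\<lambda>k. g ((s \<circ> (r \<circ> q)) k) j)" by (auto simp: convergent_def o_def)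
      then show ?thesis using strict_mono_o[OF r(1) q(1)] by blast
    qed
  next
    fix j and s r :: "nat \<Rightarrow> nat"
    assume P: "?P j s" and r: "strict_mono r"
    from P show "?P j (s \<circ> r)"
    proof
      assume "convergent (\<lambda>k. g (s k) j)"
      from convergent_subseq_convergent[OF this r] show ?thesis by (simp add: o_def)
    next
      assume "filterlim (\<lambda>k. g (s k) j) at_infinity sequentially"
      from filterlim_compose[OF this filterlim_subseq[OF r]] show ?thesis by (simp add: o_def)
    qed
  next
    fix s :: "nat \<Rightarrow> nat"
    assume "strict_mono s" "\<And>j. j \<in> {..<n} \<Longrightarrow> ?P j s"
    then show thesis by (rule that)
  qed
  define I where "I = {j \<in> {..<n}. convergent (\<lambda>k. g (s k) j)}"
  define x where "x j = lim (\<lambda>k. g (s k) j)" for j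
  have conv: "(\<lambda>k. g (s k) j) \<longlonglongrightarrow> x j" if "j \<in> I" for j
    using that by (simp add: I_def x_def convergent_LIMSEQ_iff)
  have div: "filterlim (\<lambda>k. g (s k) j) at_infinity sequentially" if "j \<in> {..<n} - I" for j
    using sP[of j] that by (auto simp: I_def)
  define A where "A k = (?D + inverse (real (Suc (s k)))) powr p" for k
  have intA: "(\<integral>\<omega>. F_bar N p (X \<omega>) (g (s k) ` {..<n}) powr p \<partial>M) \<le> A k" for k
    unfolding A_def
    using error_le_iff[of "?D + inverse (real (Suc (s k)))" n "g (s k)"] g[of "s k"] opt_nonneg[of n]
    by (simp add: add_nonneg_nonneg)
  have "(\<lambda>k. ?D + inverse (real (Suc (s k)))) \<longlonglongrightarrow> ?D + 0"
    using LIMSEQ_subseq_LIMSEQ[OF LIMSEQ_inverse_real_of_nat s]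
    by (intro tendsto_add tendsto_const) (simp add: o_def)
  then have limA: "A \<longlonglongrightarrow> ?D powr p"
    unfolding A_def using p opt_nonneg[of n] by (intro tendsto_powr') (auto intro!: always_eventually)
  have IJ: "I \<subseteq> {..<n}" by (auto simp: I_def)
  have J: "finite {..<n}" "{..<n} \<noteq> {}" using n by (auto simp: lessThan_empty_iff)
  note lim = integral_F_bar_liminf[of "{..<n}" I "\<lambda>k. g (s k)" x A, OF J IJ conv div intA limA]
  obtain i0 where i0: "i0 \<in> I" using lim(1) by blast
  \<comment> \<open>Escaped indices are refilled with the limit point \<open>x i0\<close>: the error
    depends only on the set of values, so repetitions are harmless and a tuple of full length
    \<open>n\<close> results.\<close>
  define \<gamma> where "\<gamma> = (\<lambda>i\<in>{..<n}. if i \<in> I then x i else x i0)"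
  have "\<gamma> ` {..<n} = x ` I" using i0 IJ by (force simp: \<gamma>_def image_iff)
  then have le: "error n \<gamma> \<le> ?D" using lim(2) by (simp add: error_le_iff opt_nonneg)
  show ?thesis
  proof (intro bexI[of _ \<gamma>] ballI)
    show "error n \<gamma> \<le> error n \<gamma>'" if "\<gamma>' \<in> tuples n" for \<gamma>'
      using le opt_le_error[OF that] by simp
  qed (simp add: \<gamma>_def)
qed

lemma antimono_opt: "antimono_on {1..} (opt_dual_error N M p X)"
proof (rule monotone_onI)
  fix n m :: nat
  assume n: "n \<in> {1..}" and nm: "n \<le> m"
  show "opt_dual_error N M p X m \<le> opt_dual_error N M p X n"
    unfolding opt_dual_error_def[of _ _ _ _ n]
  proof (rule cINF_greatest)
    fix \<gamma> :: "nat \<Rightarrow> 'a"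
    \<comment> \<open>Padding repeats the entry \<open>\<gamma> 0\<close>, which belongs to the
      tuple because \<open>n\<close> is at least 1, and leaves the set of values unchanged.\<close>
    define \<gamma>' where "\<gamma>' = (\<lambda>i\<in>{..<m}. if i < n then \<gamma> i else \<gamma> 0)"
    have "\<gamma>' ` {..<m} = \<gamma> ` {..<n}" using n nm by (force simp: \<gamma>'_def image_iff)
    then have "error m \<gamma>' = error n \<gamma>" by (simp add: dual_error_def)
    moreover have "\<gamma>' \<in> tuples m" by (simp add: \<gamma>'_def)
    ultimately show "opt_dual_error N M p X m \<le> error n \<gamma>" using opt_le_error by metis
  qed (simp add: PiE_eq_empty_iff)
qed

text \<open>The set with index \<open>k\<close> is adapted to radius \<open>k + 1\<close> and
  accuracy \<open>1 / (k + 1)\<close>, so every fixed point is eventually covered with vanishing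
  value.\<close>

lemma integral_F_bar_tendsto_0:
  "\<exists>\<Gamma> :: nat \<Rightarrow> 'a set. (\<forall>k. finite (\<Gamma> k) \<and> \<Gamma> k \<noteq> {}) \<and>
    (\<lambda>k. \<integral>\<omega>. F_bar N p (X \<omega>) (\<Gamma> k) powr p \<partial>M) \<longlonglongrightarrow> 0"
proof -
  have "\<exists>\<Gamma>. finite \<Gamma> \<and> \<Gamma> \<noteq> {} \<and> \<Gamma> \<subseteq> cball 0 (real (Suc k) + 1) \<and>
      (\<forall>\<xi>. norm \<xi> \<le> real (Suc k) \<longrightarrow> F_bar N p \<xi> \<Gamma> \<le> inverse (real (Suc k)))" for k
    by (rule small_F_bar_on_ball[of "inverse (real (Suc k))" "real (Suc k)"]) auto
  then obtain \<Gamma> where fin: "\<And>k. finite (\<Gamma> k)" and ne: "\<And>k. \<Gamma> k \<noteq> {}"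
    and sub: "\<And>k. \<Gamma> k \<subseteq> cball 0 (real (Suc k) + 1)"
    and small: "\<And>k \<xi>. norm \<xi> \<le> real (Suc k) \<Longrightarrow> F_bar N p \<xi> (\<Gamma> k) \<le> inverse (real (Suc k))"
    by metis
  obtain B where B: "0 < B" "\<And>x. N x \<le> B * norm x" using N_upper by blast
  obtain b where b: "0 < b" "\<And>x. b * norm x \<le> N x" using N_lower by blast
  \<comment> \<open>\<open>1 + B / b\<close> and \<open>B\<close> are the two coefficients in the
    estimate outside the ball; the leading 1 also covers the bound
    \<open>inverse (real (Suc k)) \<le> 1\<close> inside it.\<close>
  define K where "K = 1 + B / b + B"
  have K: "1 \<le> K" using B b by (simp add: K_def)
  have bound: "F_bar N p \<xi> (\<Gamma> k) \<le> K * N \<xi> + K" for \<xi> k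
  proof (cases "norm \<xi> \<le> real (Suc k)")
    case True
    have "inverse (real (Suc k)) \<le> 1" by (simp add: field_simps)
    moreover have "0 \<le> K * N \<xi>" using K by simp
    ultimately show ?thesis using small[OF True] K by linarith
  next
    case False
    show ?thesis
    proof (rule F_bar_le_max[OF fin ne])
      fix x assume "x \<in> \<Gamma> k"
      \<comment> \<open>Outside the ball the radius is less than \<open>norm \<xi>\<close>, so the
        bound on the points becomes one in terms of \<xi> alone and no longer depends on
        \<open>k\<close>.\<close>
      then have "norm x \<le> norm \<xi> + 1" using sub[of k] False by force
      also have "\<dots> \<le> N \<xi> / b + 1" using b by (simp add: pos_le_divide_eq mult.commute)
      finally have "B * norm x \<le> B * (N \<xi> / b + 1)" using B(1) by (intro mult_left_mono) auto
      moreover have "N (\<xi> - x) \<le> N \<xi> + B * norm x" using N_diff_le[of \<xi> x] B(2)[of x] by linarith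
      ultimately have "N (\<xi> - x) \<le> N \<xi> + B * (N \<xi> / b + 1)" by linarith
      also have "\<dots> \<le> K * N \<xi> + K"
        using B(1) b(1) by (simp add: K_def algebra_simps)
      finally show "N (\<xi> - x) \<le> K * N \<xi> + K" .
    qed
  qed
  have "(\<lambda>k. \<integral>\<omega>. F_bar N p (X \<omega>) (\<Gamma> k) powr p \<partial>M) \<longlonglongrightarrow> (\<integral>\<omega>. 0 \<partial>M)"
  proof (rule integral_dominated_convergence)
    show "integrable M (\<lambda>\<omega>. 2 powr p * (K powr p * N (X \<omega>) powr p + K powr p))"
      using X_integrable by simp
    show "(\<lambda>\<omega>. F_bar N p (X \<omega>) (\<Gamma> k) powr p) \<in> borel_measurable M" for k
      using integrable_F_bar[OF fin ne] by (rule borel_measurable_integrable)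
    show "AE \<omega> in M. (\<lambda>k. F_bar N p (X \<omega>) (\<Gamma> k) powr p) \<longlonglongrightarrow> 0"
    proof (rule AE_I2)
      fix \<omega>
      have "(\<lambda>k. F_bar N p (X \<omega>) (\<Gamma> k)) \<longlonglongrightarrow> 0"
      proof (rule tendsto_sandwich[OF _ _ tendsto_const LIMSEQ_inverse_real_of_nat])
        show "\<forall>\<^sub>F k in sequentially. 0 \<le> F_bar N p (X \<omega>) (\<Gamma> k)"
          using F_bar_nonneg[OF fin ne] by simp
        have "\<forall>\<^sub>F k in sequentially. norm (X \<omega>) \<le> real k"
          by (rule eventually_sequentiallyI[of "nat \<lceil>norm (X \<omega>)\<rceil>"]) linarith
        then show "\<forall>\<^sub>F k in sequentially. F_bar N p (X \<omega>) (\<Gamma> k) \<le> inverse (real (Suc k))"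
          by eventually_elim (rule small, simp)
      qed
      from tendsto_powr'[OF this tendsto_const[of p]] show "(\<lambda>k. F_bar N p (X \<omega>) (\<Gamma> k) powr p) \<longlonglongrightarrow> 0"
        using p F_bar_nonneg[OF fin ne] by simp
    qed
    show "AE \<omega> in M. norm (F_bar N p (X \<omega>) (\<Gamma> k) powr p)
        \<le> 2 powr p * (K powr p * N (X \<omega>) powr p + K powr p)" for k
    proof (rule AE_I2)
      fix \<omega>
      have "F_bar N p (X \<omega>) (\<Gamma> k) powr p \<le> (K * N (X \<omega>) + K) powr p"
        using p bound F_bar_nonneg[OF fin ne] by (intro powr_mono2) auto
      also have "\<dots> \<le> 2 powr p * ((K * N (X \<omega>)) powr p + K powr p)"
        using K p by (intro powr_add_le) auto
      finally show "norm (F_bar N p (X \<omega>) (\<Gamma> k) powr p)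
          \<le> 2 powr p * (K powr p * N (X \<omega>) powr p + K powr p)"
        using K by (simp add: powr_mult)
    qed
  qed simp
  then show ?thesis using fin ne by (intro exI[of _ \<Gamma>]) simp
qed

text \<open>A single \<open>n\<close>, the size of one good finite set, suffices:
  \<open>antimono_opt\<close> carries the small value to every larger number of points.\<close>

lemma opt_tendsto_0: "opt_dual_error N M p X \<longlonglongrightarrow> 0"
proof (rule LIMSEQ_I)
  fix e :: real
  assume e: "0 < e"
  obtain \<Gamma> :: "nat \<Rightarrow> 'a set" where \<Gamma>: "\<forall>k. finite (\<Gamma> k) \<and> \<Gamma> k \<noteq> {}"
    and lim: "(\<lambda>k. \<integral>\<omega>. F_bar N p (X \<omega>) (\<Gamma> k) powr p \<partial>M) \<longlonglongrightarrow> 0"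
    using integral_F_bar_tendsto_0 by (elim exE conjE)
  have fin: "finite (\<Gamma> k)" and ne: "\<Gamma> k \<noteq> {}" for k using \<Gamma> by simp_all
  have "0 < (e / 2) powr p" using e by simp
  from eventually_happens'[OF sequentially_bot order_tendstoD(2)[OF lim this]]
  obtain k where k: "(\<integral>\<omega>. F_bar N p (X \<omega>) (\<Gamma> k) powr p \<partial>M) < (e / 2) powr p" ..
  define n where "n = card (\<Gamma> k)"
  have n: "1 \<le> n" using fin ne by (simp add: n_def Suc_le_eq card_gt_0_iff)
  obtain h where "bij_betw h {0..<n} (\<Gamma> k)"
    using ex_bij_betw_nat_finite[OF fin] unfolding n_def by blast
  then have h: "restrict h {..<n} ` {..<n} = \<Gamma> k"
    by (simp add: bij_betw_def atLeast0LessThan)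
  have "error n (restrict h {..<n}) \<le> e / 2"
    unfolding error_le_iff[OF less_imp_le[OF half_gt_zero[OF e]]] h using k by simp
  moreover have "opt_dual_error N M p X n \<le> error n (restrict h {..<n})"
    by (rule opt_le_error) simp
  ultimately have small: "opt_dual_error N M p X n < e" using e by linarith
  have "norm (opt_dual_error N M p X m - 0) < e" if "n \<le> m" for m
  proof -
    have "opt_dual_error N M p X m \<le> opt_dual_error N M p X n"
      using antimono_opt n that by (auto simp: monotone_on_def)
    then show ?thesis using small opt_nonneg[of m] by simp
  qed
  then show "\<exists>n0. \<forall>m\<ge>n0. norm (opt_dual_error N M p X m - 0) < e" by blast
qed

end

theorem theorem6:
  fixes N :: "real ^ 'd \<Rightarrow> real"
    and M :: "'w measure"
    and X :: "'w \<Rightarrow> real ^ 'd"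
    and p :: real
  assumes "is_norm N"
    and "prob_space M"
    and "p > 1"
    and "X \<in> borel_measurable M"
    and "integrable M (\<lambda>\<omega>. N (X \<omega>) powr p)"
    and "strongly_continuous (distr M borel X)"
    and "interior (measure_support (distr M borel X)) \<noteq> {}"
  shows "(\<forall>n\<ge>1. lower_semicontinuous_map (tuple_topology n) (dual_error N M p X n)) \<and>
         (\<forall>n\<ge>1. \<exists>\<gamma>\<in>tuples n. \<forall>\<gamma>'\<in>tuples n. dual_error N M p X n \<gamma> \<le> dual_error N M p X n \<gamma>') \<and>
         antimono_on {1..} (opt_dual_error N M p X) \<and>
         opt_dual_error N M p X \<longlonglongrightarrow> 0"
proof -
  interpret dual_quantization_vector N p M X
    using assms
    by (auto simp: dual_quantization_vector_def dual_quantization_vector_axioms_def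
        dual_quantization_def dual_quantization_axioms_def fixed_norm_def)
  show ?thesis
    using lower_semicontinuous_error opt_attained antimono_opt opt_tendsto_0 by blast
qed

end
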